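(* Let $G$ be a graph with $n$ vertices and $p\binom{n}{2}$ edges, where $0<p<1$. Then $$\operatorname{grdisc}(G)\le\begin{cases}\dfrac{1+p}{2}(n-1), & 0<p<\frac13,\\[6pt] \max\{p,1-p\}(n-1), & \frac13\le p\le\frac23,\\[6pt] \left(1-\dfrac p2\right)(n-1), & \frac23<p<1.\end{cases}$$ Consequently, the function $c(p,n)$ satisfies $$c(p,n)\le\begin{cases}\dfrac{1+p}{2}(n-1), & 0<p<\frac13,\\[6pt] \max\{p,1-p\}(n-1), & \frac13\le p\le\frac23,\\[6pt] \left(1-\dfrac p2\right)(n-1), & \frac23<p<1.\end{cases}$$
   Context: Graphs are finite and simple, and $n\ge 2$. For a graph $G$ with $n$ vertices and $p\binom n2$ edges (so $p=e(G)/\binom n2$ is the edge density), and a set $S\subseteq V(G)$, let $e(S)$ be the number of edges of $G$ induced by $S$. The graded discrepancy of $G$ is $$\operatorname{grdisc}(G)=\min_{v_1,\dots,v_n}\ \max_{1\le i\le n}\left|e(\{v_1,\dots,v_i\})-p\binom i2\right|,$$ where the minimum is over all orderings $v_1,\dots,v_n$ of the vertices of $G$. For $n$ and $p$ such that $p\binom n2$ is an integer, $c(p,n)$ is the maximum of $\operatorname{grdisc}(G)$ over all graphs $G$ with $n$ vertices and exactly $p\binom n2$ edges. *)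

theory Defs
  imports Complex_Main "HOL-Library.Ramsey" "HOL-Combinatorics.Multiset_Permutations"
begin

text \<open>A graph is a vertex set together with a set of two-element subsets of it
  (\<open>nsets V 2\<close> is the set of two-element subsets of \<open>V\<close>).\<close>

definition simple_graph :: "'a set \<Rightarrow> 'a set set \<Rightarrow> bool" where
  "simple_graph V E \<longleftrightarrow> finite V \<and> E \<subseteq> nsets V 2"

definition edge_density :: "'a set \<Rightarrow> 'a set set \<Rightarrow> real" where
  "edge_density V E = real (card E) / real (card V choose 2)"

definition induced_edges :: "'a set set \<Rightarrow> 'a set \<Rightarrow> nat" where
  "induced_edges E S = card {e \<in> E. e \<subseteq> S}"

text \<open>A vertex ordering \<open>v\<^sub>1, \<dots>, v\<^sub>n\<close> is a duplicate-free list \<open>vs\<close> enumerating \<open>V\<close>;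
  its initial segment \<open>{v\<^sub>1, \<dots>, v\<^sub>i}\<close> is \<open>set (take i vs)\<close>.\<close>

definition ordering_disc :: "'a set \<Rightarrow> 'a set set \<Rightarrow> 'a list \<Rightarrow> real" where
  "ordering_disc V E vs =
     Max ((\<lambda>i. \<bar>real (induced_edges E (set (take i vs))) - edge_density V E * real (i choose 2)\<bar>)
          ` {1..card V})"

definition grdisc :: "'a set \<Rightarrow> 'a set set \<Rightarrow> real" where
  "grdisc V E = Min (ordering_disc V E ` permutations_of_set V)"

text \<open>The maximum \<open>c(p,n)\<close> over all graphs with \<open>n\<close> vertices and \<open>p\<close> times \<open>n choose 2\<close> edges.
  It is taken over the labelled graphs on \<open>{..<n}\<close>, which loses no value of \<open>grdisc\<close>: see
  \<open>grdisc_relabel\<close> below. The set is empty, and the value meaningless, unless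
  \<open>p * real (n choose 2)\<close> is one of the integers \<open>0, \<dots>, n choose 2\<close>.\<close>

definition max_grdisc :: "real \<Rightarrow> nat \<Rightarrow> real" where
  "max_grdisc p n =
     Max {grdisc {..<n} E | E. simple_graph {..<n} E \<and> real (card E) = p * real (n choose 2)}"

definition grdisc_bound :: "real \<Rightarrow> nat \<Rightarrow> real" where
  "grdisc_bound p n =
     (if p < 1/3 then (1 + p) / 2 * (real n - 1)
      else if p \<le> 2/3 then max p (1 - p) * (real n - 1)
      else (1 - p / 2) * (real n - 1))"

lemma grdisc_image:
  assumes G: "simple_graph V E" and f: "inj_on f V"
  shows "simple_graph (f ` V) ((`) f ` E)"
    and "card ((`) f ` E) = card E"
    and "grdisc (f ` V) ((`) f ` E) = grdisc V E"
proof -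
  have EV: "e \<subseteq> V" "card e = 2" if "e \<in> E" for e
    using G that by (auto simp: simple_graph_def nsets_def)
  have inj: "inj_on ((`) f) (Pow V)"
    using f by (rule inj_on_image_Pow)
  show "simple_graph (f ` V) ((`) f ` E)"
    unfolding simple_graph_def nsets_def
  proof (intro conjI subsetI)
    show "finite (f ` V)" using G by (simp add: simple_graph_def)
    fix e' assume "e' \<in> (`) f ` E"
    then obtain e where e: "e \<in> E" "e' = f ` e" by blast
    have "card e' = 2"
      using e EV f by (metis card_image inj_on_subset)
    moreover have "finite e'"
      using \<open>card e' = 2\<close> card.infinite by fastforce
    ultimately show "e' \<in> {N. N \<subseteq> f ` V \<and> finite N \<and> card N = 2}"
      using e EV by auto
  qed
  show cE: "card ((`) f ` E) = card E"
    by (rule card_image, rule inj_on_subset[OF inj]) (use EV in auto)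
  have ind: "induced_edges ((`) f ` E) (f ` S) = induced_edges E S" if S: "S \<subseteq> V" for S
  proof -
    have "{e \<in> (`) f ` E. e \<subseteq> f ` S} = (`) f ` {e \<in> E. e \<subseteq> S}"
    proof -
      have "f ` e \<subseteq> f ` S \<longleftrightarrow> e \<subseteq> S" if "e \<in> E" for e
      proof
        assume *: "f ` e \<subseteq> f ` S"
        show "e \<subseteq> S"
        proof
          fix x assume "x \<in> e"
          with * EV(1)[OF that] have "x \<in> V" "f x \<in> f ` S" by auto
          then show "x \<in> S" using inj_on_image_mem_iff[OF f _ S] by blast
        qed
      qed auto
      then show ?thesis by auto
    qed
    moreover have "inj_on ((`) f) {e \<in> E. e \<subseteq> S}"
      by (rule inj_on_subset[OF inj]) (use EV in auto)
    ultimately show ?thesis by (simp add: induced_edges_def card_image)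
  qed
  have disc: "ordering_disc (f ` V) ((`) f ` E) (map f vs) = ordering_disc V E vs"
    if "vs \<in> permutations_of_set V" for vs
  proof -
    have "set vs = V" using that by (simp add: permutations_of_set_def)
    then have "set (take i vs) \<subseteq> V" for i by (metis set_take_subset)
    then show ?thesis
      unfolding ordering_disc_def edge_density_def
      by (simp add: card_image[OF f] cE ind take_map)
  qed
  have "permutations_of_set (f ` V) = map f ` permutations_of_set V"
    using f by (rule permutations_of_set_image_inj)
  then show "grdisc (f ` V) ((`) f ` E) = grdisc V E"
    unfolding grdisc_def by (simp add: image_image disc cong: image_cong)
qed

lemma grdisc_relabel:
  assumes "simple_graph V E" and "card V = n"
  shows "\<exists>E'. simple_graph {..<n} E' \<and> card E' = card E \<and> grdisc {..<n} E' = grdisc V E"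
proof -
  have "finite V" using assms by (simp add: simple_graph_def)
  then obtain f where "bij_betw f V {..<n}"
    using assms(2) by (metis ex_bij_betw_finite_nat lessThan_atLeast0)
  then have f: "inj_on f V" "f ` V = {..<n}" by (auto simp: bij_betw_def)
  show ?thesis
    using grdisc_image[OF assms(1) f(1)] f(2) by metis
qed

end

theory Submission
  imports Defs
begin

text \<open>
  The proof gives \<open>(n - 1) / 2\<close> as an upper bound on the graded discrepancy for every density,
  and each branch of \<open>grdisc_bound\<close> is at least that large.

  Write \<open>f S = e(S) - p * (card S choose 2)\<close>, so that \<open>f V = 0\<close>, and build the ordering backwards
  by deleting one vertex at a time from \<open>V\<close>. Two facts control a deletion from a set \<open>S\<close> with
  \<open>k\<close> elements. The average of \<open>f (S - {v})\<close> over \<open>v \<in> S\<close> is \<open>(1 - 2 / k) * f S\<close>, since every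
  pair of vertices survives \<open>k - 2\<close> of the \<open>k\<close> possible deletions (\<open>sum_excess_delete\<close>). And a
  deletion removes between \<open>0\<close> and \<open>k - 1\<close> edges, so it lowers \<open>f\<close> by at most
  \<open>(1 - p) * (n - 1)\<close> and raises it by at most \<open>p * (n - 1)\<close> (\<open>excess_delete_bounds\<close>).

  The deletions must keep \<open>f\<close> inside the window \<open>[-(n - 1)/2, (n - 1)/2]\<close>, whose length
  \<open>n - 1\<close> is exactly the sum of the two maximal step sizes. Hence there is a threshold
  \<open>t = (1/2 - p) * (n - 1)\<close> such that from values at least \<open>t\<close> no step leaves the window
  downwards, and from values at most \<open>t\<close> no step leaves it upwards. Above \<open>t\<close> delete
  a vertex for which the new value does not exceed the average; below \<open>t\<close>, one for which it is
  not less than the average. As the average lies between \<open>0\<close> and \<open>f S\<close> when \<open>k \<ge> 2\<close>,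
  the other end of the window is respected as well (\<open>exists_balanced_deletion\<close>).
\<close>

definition excess :: "'a set set \<Rightarrow> real \<Rightarrow> 'a set \<Rightarrow> real" where
  "excess E p S = real (induced_edges E S) - p * real (card S choose 2)"

lemma real_choose_two: "real (k choose 2) = real k * (real k - 1) / 2"
  by (induction k) (auto simp: numeral_2_eq_2 field_simps)

lemma simple_graph_finite_edges:
  assumes "simple_graph V E"
  shows "finite E"
  using assms finite_imp_finite_nsets finite_subset unfolding simple_graph_def by blast

lemma simple_graph_edge:
  assumes "simple_graph V E" "e \<in> E"
  shows "finite e" "card e = 2" "e \<subseteq> V"
  using assms by (auto simp: simple_graph_def nsets_def)

lemma excess_delete_bounds:
  assumes G: "simple_graph V E" and S: "finite S" and v: "v \<in> S"
  shows "excess E p S - (1 - p) * (real (card S) - 1) \<le> excess E p (S - {v})"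
    and "excess E p (S - {v}) \<le> excess E p S + p * (real (card S) - 1)"
proof -
  let ?old = "{e \<in> E. e \<subseteq> S}" and ?new = "{e \<in> E. e \<subseteq> S - {v}}"
  let ?star = "(\<lambda>u. {v, u}) ` (S - {v})"
  have finE: "finite E" by (rule simple_graph_finite_edges[OF G])
  have k: "card S \<ge> 1" using S v by (simp add: Suc_le_eq card_gt_0_iff) blast
  have card': "card (S - {v}) = card S - 1" using v by simp
  have "?new \<subseteq> ?old" by blast
  then have lower: "induced_edges E (S - {v}) \<le> induced_edges E S"
    unfolding induced_edges_def using finE by (simp add: card_mono)
  have "?old \<subseteq> ?new \<union> ?star"
  proof
    fix e assume e: "e \<in> ?old"
    show "e \<in> ?new \<union> ?star"
    proof (cases "v \<in> e")
      case True
      have "card e = 2" using simple_graph_edge[OF G] e by blast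
      then obtain u where "e = {v, u}" "u \<noteq> v"
        using True unfolding card_2_iff by (metis insert_commute insert_iff singletonD)
      then show ?thesis using e by auto
    qed (use e in auto)
  qed
  then have "card ?old \<le> card (?new \<union> ?star)"
    using finE S by (intro card_mono) auto
  also have "\<dots> \<le> card ?new + card ?star" by (rule card_Un_le)
  also have "card ?star \<le> card S - 1"
    using S card' by (metis card_image_le finite_Diff)
  finally have upper: "induced_edges E S \<le> induced_edges E (S - {v}) + (card S - 1)"
    unfolding induced_edges_def by simp
  have pairs: "real (card (S - {v}) choose 2) = real (card S choose 2) - (real (card S) - 1)"
    using k unfolding card' real_choose_two by (simp add: of_nat_diff field_simps)
  show "excess E p S - (1 - p) * (real (card S) - 1) \<le> excess E p (S - {v})"
    using upper k unfolding excess_def pairs by (simp add: algebra_simps)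
  show "excess E p (S - {v}) \<le> excess E p S + p * (real (card S) - 1)"
    using lower unfolding excess_def pairs by (simp add: algebra_simps)
qed

text \<open>Edges and pairs are counted in the same way: each of them survives the deletion of
  every vertex except its own two endpoints.\<close>

lemma sum_excess_delete:
  assumes G: "simple_graph V E" and S: "finite S" and k: "card S \<ge> 1"
  shows "(\<Sum>v\<in>S. excess E p (S - {v})) = (real (card S) - 2) * excess E p S"
proof -
  let ?F = "{e \<in> E. e \<subseteq> S}"
  have finF: "finite ?F" using simple_graph_finite_edges[OF G] by simp
  have del: "{e \<in> E. e \<subseteq> S - {v}} = {e \<in> ?F. v \<notin> e}" for v by blast
  have "(\<Sum>v\<in>S. real (induced_edges E (S - {v}))) = real (\<Sum>v\<in>S. card {e \<in> ?F. v \<notin> e})"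
    unfolding induced_edges_def del by simp
  also have "(\<Sum>v\<in>S. card {e \<in> ?F. v \<notin> e}) = (\<Sum>e\<in>?F. card {v \<in> S. v \<notin> e})"
    using sum.swap_restrict[OF S finF, of "\<lambda>_ _. 1 :: nat" "\<lambda>v e. v \<notin> e"] by simp
  also have "real \<dots> = (\<Sum>e\<in>?F. real (card S) - 2)"
  proof -
    have "real (card {v \<in> S. v \<notin> e}) = real (card S) - 2" if "e \<in> ?F" for e
    proof -
      have "{v \<in> S. v \<notin> e} = S - e" by blast
      moreover have "finite e" "card e = 2" "e \<subseteq> S"
        using that simple_graph_edge[OF G] by auto
      moreover have "card e \<le> card S" using \<open>e \<subseteq> S\<close> S by (rule card_mono[rotated])
      ultimately show ?thesis by (simp add: card_Diff_subset of_nat_diff)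
    qed
    then show ?thesis by simp
  qed
  also have "\<dots> = (real (card S) - 2) * real (induced_edges E S)"
    by (simp add: induced_edges_def)
  finally have edges: "(\<Sum>v\<in>S. real (induced_edges E (S - {v}))) = \<dots>" .
  have "(\<Sum>v\<in>S. real (card (S - {v}) choose 2)) = real (card S) * real ((card S - 1) choose 2)"
    by simp
  also have "\<dots> = (real (card S) - 2) * real (card S choose 2)"
    using k unfolding real_choose_two by (simp add: of_nat_diff)
  finally have pairs: "(\<Sum>v\<in>S. real (card (S - {v}) choose 2)) = \<dots>" .
  have "(\<Sum>v\<in>S. excess E p (S - {v}))
      = (\<Sum>v\<in>S. real (induced_edges E (S - {v}))) - p * (\<Sum>v\<in>S. real (card (S - {v}) choose 2))"
    unfolding excess_def by (simp add: sum_subtractf sum_distrib_left)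
  then show ?thesis
    unfolding edges pairs excess_def by (simp add: algebra_simps)
qed

lemma exists_le_and_ge_average:
  fixes g :: "'a \<Rightarrow> real"
  assumes "finite S" "S \<noteq> {}" "sum g S = real (card S) * m"
  shows "\<exists>v\<in>S. g v \<le> m" and "\<exists>v\<in>S. m \<le> g v"
proof -
  show "\<exists>v\<in>S. g v \<le> m"
  proof (rule ccontr)
    assume "\<not> ?thesis"
    then have "(\<Sum>v\<in>S. m) < sum g S" using assms by (intro sum_strict_mono) auto
    then show False using assms by simp
  qed
  show "\<exists>v\<in>S. m \<le> g v"
  proof (rule ccontr)
    assume "\<not> ?thesis"
    then have "sum g S < (\<Sum>v\<in>S. m)" using assms by (intro sum_strict_mono) auto
    then show False using assms by simp
  qed
qed

text \<open>For at least two vertices the average \<open>m\<close> after a deletion is \<open>excess E p S\<close> scaled by a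
  factor in \<open>[0, 1]\<close>, hence lies in the window. So one end of the window is respected because
  the new value is on the right side of \<open>m\<close>, and the other because the threshold leaves room
  for a largest possible step.\<close>

lemma exists_balanced_deletion:
  assumes G: "simple_graph V E" and S: "finite S" "S \<noteq> {}" "card S \<le> n"
    and p: "0 \<le> p" "p \<le> 1"
    and win: "\<bar>excess E p S\<bar> \<le> (real n - 1) / 2"
  shows "\<exists>v\<in>S. \<bar>excess E p (S - {v})\<bar> \<le> (real n - 1) / 2"
proof (cases "card S = 1")
  case True
  then obtain v where "S = {v}" by (auto simp: card_1_singleton_iff)
  moreover have "{e \<in> E. e \<subseteq> {}} = {}" using simple_graph_edge(2)[OF G] by fastforce
  then have "excess E p {} = 0" by (simp add: excess_def induced_edges_def real_choose_two)
  ultimately show ?thesis using S by simp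
next
  case False
  let ?f = "excess E p" and ?B = "(real n - 1) / 2" and ?k = "real (card S)"
  have "card S \<noteq> 0" using S by simp
  then have k: "card S \<ge> 2" using False by linarith
  define r where "r = (?k - 2) / ?k"
  define m where "m = r * ?f S"
  have r: "0 \<le> r" "r \<le> 1" using k unfolding r_def by (simp_all add: divide_simps)
  have "\<bar>m\<bar> \<le> 1 * \<bar>?f S\<bar>"
    unfolding m_def abs_mult using r by (intro mult_right_mono) auto
  then have m: "\<bar>m\<bar> \<le> ?B" using win by linarith
  have avg: "(\<Sum>v\<in>S. ?f (S - {v})) = ?k * m"
    using sum_excess_delete[OF G S(1), of p] k unfolding m_def r_def by simp
  have step: "(1 - p) * (?k - 1) \<le> (1 - p) * (real n - 1)" "p * (?k - 1) \<le> p * (real n - 1)"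
    using p S(3) by (intro mult_left_mono; simp)+
  show ?thesis
  proof (cases "?f S \<ge> (1 / 2 - p) * (real n - 1)")
    case True
    obtain v where v: "v \<in> S" "?f (S - {v}) \<le> m"
      using exists_le_and_ge_average(1)[OF S(1,2) avg] by blast
    have "?f (S - {v}) \<ge> (1 / 2 - p) * (real n - 1) - (1 - p) * (real n - 1)"
      using excess_delete_bounds(1)[OF G S(1) v(1), of p] step True by linarith
    then have "?f (S - {v}) \<ge> - ?B" by (simp add: field_simps)
    then have "\<bar>?f (S - {v})\<bar> \<le> ?B" using v(2) m by linarith
    then show ?thesis using v(1) by blast
  next
    case False
    obtain v where v: "v \<in> S" "m \<le> ?f (S - {v})"
      using exists_le_and_ge_average(2)[OF S(1,2) avg] by blast
    have "?f (S - {v}) \<le> (1 / 2 - p) * (real n - 1) + p * (real n - 1)"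
      using excess_delete_bounds(2)[OF G S(1) v(1), of p] step False by linarith
    then have "?f (S - {v}) \<le> ?B" by (simp add: field_simps)
    then have "\<bar>?f (S - {v})\<bar> \<le> ?B" using v(2) m by linarith
    then show ?thesis using v(1) by blast
  qed
qed

lemma ordering_from_deletions:
  assumes "finite S" "P S"
    and "\<And>T. T \<subseteq> S \<Longrightarrow> T \<noteq> {} \<Longrightarrow> P T \<Longrightarrow> \<exists>v\<in>T. P (T - {v})"
  shows "\<exists>vs \<in> permutations_of_set S. \<forall>i. P (set (take i vs))"
  using assms
proof (induction "card S" arbitrary: S)
  case 0
  then show ?case by simp
next
  case (Suc k)
  then have "S \<noteq> {}" by auto
  then obtain v where v: "v \<in> S" "P (S - {v})" using Suc.prems by blast
  have "\<exists>vs \<in> permutations_of_set (S - {v}). \<forall>i. P (set (take i vs))"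
    using Suc.hyps(2) v Suc.prems by (intro Suc.hyps(1)) auto
  then obtain vs where vs: "vs \<in> permutations_of_set (S - {v})" "\<And>i. P (set (take i vs))"
    by blast
  have all: "vs @ [v] \<in> permutations_of_set S"
    using vs(1) v by (auto simp: permutations_of_set_def)
  have "P (set (take i (vs @ [v])))" for i
  proof (cases "i \<le> length vs")
    case True
    then show ?thesis using vs(2) by simp
  next
    case False
    then have "take i (vs @ [v]) = vs @ [v]" by simp
    then show ?thesis
      using all Suc.prems(2) by (metis permutations_of_setD(1))
  qed
  then show ?case using all by blast
qed

theorem grdisc_le_half:
  assumes G: "simple_graph V E" and n: "card V = n" "n \<ge> 2"
  shows "grdisc V E \<le> (real n - 1) / 2"
proof -
  let ?p = "edge_density V E"
  have finV: "finite V" using G by (simp add: simple_graph_def)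
  have pos: "real (n choose 2) > 0" using n(2) by simp
  have "card E \<le> card (nsets V 2)"
    using G finV unfolding simple_graph_def by (intro card_mono finite_imp_finite_nsets) auto
  then have "card E \<le> n choose 2" using n by (simp add: card_nsets)
  then have p: "0 \<le> ?p" "?p \<le> 1"
    using pos n unfolding edge_density_def by (simp_all add: divide_simps)
  have "{e \<in> E. e \<subseteq> V} = E" using G simple_graph_edge(3) by fastforce
  then have "excess E ?p V = 0"
    using pos n by (simp add: excess_def induced_edges_def edge_density_def)
  then have start: "\<bar>excess E ?p V\<bar> \<le> (real n - 1) / 2" using n by simp
  have "\<exists>vs \<in> permutations_of_set V. \<forall>i. \<bar>excess E ?p (set (take i vs))\<bar> \<le> (real n - 1) / 2"
  proof (rule ordering_from_deletions[where P = "\<lambda>S. \<bar>excess E ?p S\<bar> \<le> (real n - 1) / 2",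
        OF finV start])
    fix T assume T: "T \<subseteq> V" "T \<noteq> {}" "\<bar>excess E ?p T\<bar> \<le> (real n - 1) / 2"
    show "\<exists>v\<in>T. \<bar>excess E ?p (T - {v})\<bar> \<le> (real n - 1) / 2"
      using T finV n by (intro exists_balanced_deletion[OF G _ _ _ p])
        (auto intro: finite_subset card_mono)
  qed
  then obtain vs where vs: "vs \<in> permutations_of_set V"
    and bnd: "\<And>i. \<bar>excess E ?p (set (take i vs))\<bar> \<le> (real n - 1) / 2" by blast
  have len: "distinct vs" "length vs = n"
    using vs n by (auto simp: permutations_of_set_def distinct_card)
  have "ordering_disc V E vs \<le> (real n - 1) / 2"
    unfolding ordering_disc_def
  proof (rule Max.boundedI)
    show "(\<lambda>i. \<bar>real (induced_edges E (set (take i vs))) - ?p * real (i choose 2)\<bar>)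
        ` {1..card V} \<noteq> {}" using n by simp
    fix x assume "x \<in> (\<lambda>i. \<bar>real (induced_edges E (set (take i vs))) - ?p * real (i choose 2)\<bar>)
        ` {1..card V}"
    then obtain i where i: "i \<le> n"
      and x: "x = \<bar>real (induced_edges E (set (take i vs))) - ?p * real (i choose 2)\<bar>"
      using n by auto
    have "card (set (take i vs)) = i" using len i by (simp add: distinct_card)
    then show "x \<le> (real n - 1) / 2" using bnd[of i] x by (simp add: excess_def)
  qed simp
  moreover have "grdisc V E \<le> ordering_disc V E vs"
    unfolding grdisc_def using vs finV by (intro Min_le) auto
  ultimately show ?thesis by linarith
qed

lemma half_le_grdisc_bound:
  assumes "n \<ge> 1" "0 \<le> p" "p \<le> 1"
  shows "(real n - 1) / 2 \<le> grdisc_bound p n"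
proof -
  have half: "(real n - 1) / 2 \<le> c * (real n - 1)" if "1 / 2 \<le> c" for c :: real
    using mult_right_mono[OF that, of "real n - 1"] assms by simp
  show ?thesis
    unfolding grdisc_bound_def using assms
    by (simp only: split: if_split) (intro conjI impI half; simp add: max_def)
qed

text \<open>A maximum is bounded by bounding the members only if there are any, so integrality of
  the number of edges enters the second part: it makes some set of pairs a graph with density
  \<open>p\<close>.\<close>

theorem theorem1p3:
  fixes p :: real and n :: nat
  assumes "n \<ge> 2" and "0 < p" and "p < 1"
  shows "(\<forall>(V :: 'a set) E. simple_graph V E \<and> card V = n \<and> real (card E) = p * real (n choose 2)
            \<longrightarrow> grdisc V E \<le> grdisc_bound p n)
       \<and> (p * real (n choose 2) \<in> \<int> \<longrightarrow> max_grdisc p n \<le> grdisc_bound p n)"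
proof (intro conjI allI impI)
  have half: "(real n - 1) / 2 \<le> grdisc_bound p n"
    using assms by (intro half_le_grdisc_bound) auto
  fix V :: "'a set" and E
  assume "simple_graph V E \<and> card V = n \<and> real (card E) = p * real (n choose 2)"
  then show "grdisc V E \<le> grdisc_bound p n"
    using grdisc_le_half[of V E n] assms half by linarith
next
  have half: "(real n - 1) / 2 \<le> grdisc_bound p n"
    using assms by (intro half_le_grdisc_bound) auto
  let ?D = "{grdisc {..<n} E | E. simple_graph {..<n} E \<and> real (card E) = p * real (n choose 2)}"
  assume "p * real (n choose 2) \<in> \<int>"
  then obtain z where z: "p * real (n choose 2) = of_int z" by (elim Ints_cases)
  have "0 \<le> p * real (n choose 2)" using assms by simp
  then have "z \<ge> 0" using z by simp
  then have m: "real (nat z) = p * real (n choose 2)" using z by simp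
  also have "\<dots> \<le> 1 * real (n choose 2)" using assms by (intro mult_right_mono) auto
  finally have "nat z \<le> card (nsets {..<n} 2)" by (simp add: card_nsets)
  then obtain E where "E \<subseteq> nsets {..<n} 2" "card E = nat z"
    by (rule obtain_subset_with_card_n)
  then have nonempty: "?D \<noteq> {}" using m by (auto simp: simple_graph_def)
  have "?D \<subseteq> grdisc {..<n} ` Pow (nsets {..<n} 2)" by (auto simp: simple_graph_def)
  then have fin: "finite ?D"
    by (rule finite_subset) (simp add: finite_imp_finite_nsets)
  show "max_grdisc p n \<le> grdisc_bound p n"
    unfolding max_grdisc_def
  proof (rule Max.boundedI[OF fin nonempty])
    fix x assume "x \<in> ?D"
    then obtain E where "x = grdisc {..<n} E" "simple_graph {..<n} E" by blast
    then show "x \<le> grdisc_bound p n"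
      using grdisc_le_half[of "{..<n}" E n] assms half by simp
  qed
qed

end
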